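(* (Error behavior of recursive summation with triple 6op compensation.) Let $n\ge1$, $x_1,\dots,x_n\in\mathbb D$, $\tilde s=\sum_{k=1}^n x_k$ (exact sum in $\mathbb R$). Set $s_0=e_0=0$ and for $i=1,\dots,n$ let $$(y_i,u_i)=\mathrm{add6}(e_{i-1},x_i),\quad (t_i,v_i)=\mathrm{add6}(s_{i-1},y_i),\quad w_i=fl(u_i+v_i),\quad (s_i,e_i)=\mathrm{add6}(t_i,w_i).$$ Assume nearest rounding and that no overflow happens. Then there exist real numbers $\alpha_i,\beta_i,\gamma_i,\eta_i$ with $|\alpha_i|,|\beta_i|,|\gamma_i|,|\eta_i|\le\epsilon$ such that, for $i=1,\dots,n$, $$y_i=(1+\alpha_i)(e_{i-1}+x_i),\quad u_i=-\alpha_i(e_{i-1}+x_i),\quad t_i=(1+\beta_i)(s_{i-1}+y_i),\quad v_i=-\beta_i(s_{i-1}+y_i),$$ $$w_i=(1+\gamma_i)(u_i+v_i),\quad s_i=(1+\eta_i)(t_i+w_i),\quad e_i=-\eta_i(t_i+w_i),$$ $$s_i+e_i=(1-\gamma_i\beta_i+\gamma_i\alpha_i\eta_{i-1}+\gamma_i\beta_i\alpha_i\eta_{i-1})(s_{i-1}+e_{i-1})+(1-\gamma_i\alpha_i-\gamma_i\beta_i-\gamma_i\beta_i\alpha_i)x_i$$ (where $\eta_0:=0$; its value is irrelevant since $s_0+e_0=0$), and $$s_n+e_n=\sum_{k=1}^n\Big\{\prod_{i=k+1}^n(1-\gamma_i\beta_i+\gamma_i\alpha_i\eta_{i-1}+\gamma_i\beta_i\alpha_i\eta_{i-1})\Big\}(1-\gamma_k\alpha_k-\gamma_k\beta_k-\gamma_k\beta_k\alpha_k)x_k,$$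 with the empty product equal to $1$. Let $\sigma=\epsilon^2+\epsilon^3+\epsilon^4$ and $\tau=2\epsilon^2+\epsilon^3$. If moreover $n\sigma<1$, then $$|s_n+e_n-\tilde s|\le\tau\sum_{k=1}^n|x_k|+\frac{(n-1)\sigma}{1-(n-1)\sigma}\sum_{k=1}^n|x_k|+\frac{(n-1)\sigma\tau}{1-(n-1)\sigma}\sum_{k=1}^n|x_k|,$$ and $$|s_n-\tilde s|\le(1+\epsilon)\Big\{\tau\sum_{k=1}^n|x_k|+\frac{(n-1)\sigma}{1-(n-1)\sigma}\sum_{k=1}^n|x_k|+\frac{(n-1)\sigma\tau}{1-(n-1)\sigma}\sum_{k=1}^n|x_k|\Big\}+\epsilon\Big|\sum_{k=1}^n x_k\Big|.$$
   Context: Dekker's floating point number system in base $2$: let $t\ge 1$ (the number of mantissa digits, not to be confused with the variables $t_i$), $E_{\min}\le E_{\max}$ be integers and $M=2^t$. Then $\mathbb D=\{x\in\mathbb R : x=m\times2^{e},\ m,e\in\mathbb Z,\ |m|<M,\ E_{\min}\le e\le E_{\max}\}$. Nearest rounding $fl:\mathbb R\to\mathbb D$ satisfies $|fl(r)-r|\le|a-r|$ for all $a\in\mathbb D$, with ties resolved by a fixed deterministic criterion. Each floating point operation is performed as if the exact real result is produced and then rounded by $fl$. Unit round-off: $\epsilon=\tfrac12\cdot2^{1-t}=2^{-t}$. "No overflow" means that for every floating point operation performed in the algorithm (including those inside $\mathrm{add6}$), the exact real result before rounding has absolute value at most $(M-1)\times2^{E_{\max}}$. The procedure $\mathrm{add6}(x,y)$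 returns $(z,zz)$ computed by $z=fl(x+y)$, $w=fl(z-x)$, $z1=fl(y-w)$, $v=fl(w-z)$, $z2=fl(x+v)$, $zz=fl(z1+z2)$. The perturbations $\alpha_i,\beta_i,\gamma_i,\eta_i$ are real numbers (the symbol $\beta_i$ is unrelated to the base). *)

theory Defs
  imports Complex_Main
begin

(* Mantissas need not be normalised, so subnormal numbers are included (gradual underflow). *)
definition dekker_floats :: "nat \<Rightarrow> int \<Rightarrow> int \<Rightarrow> real set" where
  "dekker_floats t Emin Emax =
     {x. \<exists>m e :: int. x = of_int m * 2 powi e \<and> \<bar>m\<bar> < 2 ^ t \<and> Emin \<le> e \<and> e \<le> Emax}"

definition max_float :: "nat \<Rightarrow> int \<Rightarrow> real" where
  "max_float t Emax = (2 ^ t - 1) * 2 powi Emax"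

definition unit_roundoff :: "nat \<Rightarrow> real" where
  "unit_roundoff t = 1 / 2 * 2 powi (1 - int t)"

(* The way ties are resolved is left open; it is deterministic because fl is a function of the
   exact real number to be rounded. *)
definition nearest_rounding :: "real set \<Rightarrow> (real \<Rightarrow> real) \<Rightarrow> bool" where
  "nearest_rounding D fl \<longleftrightarrow> (\<forall>r. fl r \<in> D \<and> (\<forall>a\<in>D. \<bar>fl r - r\<bar> \<le> \<bar>a - r\<bar>))"

definition add6 :: "(real \<Rightarrow> real) \<Rightarrow> real \<Rightarrow> real \<Rightarrow> real \<times> real" where
  "add6 fl x y =
    (let z = fl (x + y);
         w = fl (z - x);
         z1 = fl (y - w);
         v = fl (w - z);
         z2 = fl (x + v);
         zz = fl (z1 + z2)
     in (z, zz))"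

(* B bounds the exact result, before rounding, of each of the six operations of add6. *)
definition add6_no_overflow :: "(real \<Rightarrow> real) \<Rightarrow> real \<Rightarrow> real \<Rightarrow> real \<Rightarrow> bool" where
  "add6_no_overflow fl B x y \<longleftrightarrow>
    (let z = fl (x + y);
         w = fl (z - x);
         z1 = fl (y - w);
         v = fl (w - z);
         z2 = fl (x + v)
     in \<bar>x + y\<bar> \<le> B \<and> \<bar>z - x\<bar> \<le> B \<and> \<bar>y - w\<bar> \<le> B \<and>
        \<bar>w - z\<bar> \<le> B \<and> \<bar>x + v\<bar> \<le> B \<and> \<bar>z1 + z2\<bar> \<le> B)"

end

(* Dividing by 2^Emin turns the floating point numbers into a finite set of integers without
   underflow. There add6 is error-free for every tie-breaking rule: if |y| <= |x|, or if the sum is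
   exact, then v = -x and the second branch z2 vanishes; otherwise |x| <= |z|, and w, v, z2 carry out
   a fast two-sum of z and -x, so z1 = y - w and z2 = x + v exactly. Since in either case z1 + z2 is
   the rounding error of x + y, which is itself a float, z + zz = x + y. Hence the rounding of
   u_i + v_i is the only loss per step, and s_i + e_i obeys a linear recurrence whose coefficients
   differ from 1 by second order terms in the unit round-off. *)
theory Submission
  imports Defs
begin

section \<open>Floating point numbers as integers on binary grids\<close>

definition int_floats :: "nat \<Rightarrow> nat \<Rightarrow> int set" where
  "int_floats t N = {m * 2 ^ j | m j. \<bar>m\<bar> < 2 ^ t \<and> j \<le> N}"

text \<open>Mantissas are not normalised, so the exponent of a float is not unique. Replacing the
  mantissa by a divisibility and a size condition lets later proofs move to a smaller exponent
  through divisibility alone.\<close>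

lemma int_floatsE:
  assumes "a \<in> int_floats t N"
  obtains j where "j \<le> N" "2 ^ j dvd a" "\<bar>a\<bar> < 2 ^ (t + j)"
proof -
  obtain m j where "a = m * 2 ^ j" "\<bar>m\<bar> < 2 ^ t" "j \<le> N"
    using assms unfolding int_floats_def by auto
  then show ?thesis using that[of j] by (simp add: abs_mult power_add)
qed

lemma int_floatsI:
  assumes "j \<le> N" "2 ^ j dvd a" "\<bar>a\<bar> < 2 ^ (t + j)"
  shows "a \<in> int_floats t N"
proof -
  obtain m where "a = m * 2 ^ j" using assms(2) by (metis dvd_def mult.commute)
  then show ?thesis using assms unfolding int_floats_def
    by (auto simp: abs_mult power_add)
qed

lemma int_floats_uminus: "a \<in> int_floats t N \<Longrightarrow> - a \<in> int_floats t N"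
  by (metis abs_minus_cancel dvd_minus_iff int_floatsE int_floatsI)

lemma power_in_int_floats:
  assumes "t \<ge> 1" "e < t + N"
  shows "2 ^ e \<in> int_floats t N"
proof (cases "e \<le> N")
  case True
  then show ?thesis using assms by (intro int_floatsI[of e]) auto
next
  case False
  then show ?thesis using assms by (intro int_floatsI[of N]) (auto simp: le_imp_power_dvd)
qed

text \<open>Admits the boundary case of \<open>int_floatsI\<close>: a magnitude of exactly
  \<open>2 ^ (t + j)\<close> is a power of two, hence representable with a larger exponent. The last
  hypothesis rules out \<open>j = N\<close>, where no larger exponent exists; this is one place
  where absence of overflow enters.\<close>

lemma int_floatsI_le:
  assumes "t \<ge> 1" "j \<le> N" "2 ^ j dvd a" "\<bar>a\<bar> \<le> 2 ^ (t + j)" "\<bar>a\<bar> \<le> (2 ^ t - 1) * 2 ^ N"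
  shows "a \<in> int_floats t N"
proof (cases "\<bar>a\<bar> = 2 ^ (t + j)")
  case True
  have "(2::int) ^ (t + j) < 2 ^ (t + N)"
    using True assms(5) zero_less_power[of "2::int" N]
    by (simp add: power_add left_diff_distrib del: zero_less_power)
  then have "2 ^ (t + j) \<in> int_floats t N" by (intro power_in_int_floats assms) auto
  then show ?thesis using True int_floats_uminus by (metis abs_if minus_minus)
next
  case False
  then show ?thesis using assms by (intro int_floatsI[of j]) auto
qed

section \<open>Rounding of integers: spacing and size of the error\<close>

locale int_rounding =
  fixes t N :: nat and g :: "int \<Rightarrow> int"
  assumes t_pos: "t \<ge> 1"
    and g_in: "g r \<in> int_floats t N"
    and g_nearest: "a \<in> int_floats t N \<Longrightarrow> \<bar>g r - r\<bar> \<le> \<bar>a - r\<bar>"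
begin

lemma g_id: "r \<in> int_floats t N \<Longrightarrow> g r = r"
  using g_nearest[of r r] by simp

text \<open>Nearest rounding cannot jump over a float: compare with \<open>a\<close> if
  \<open>r\<close> is nonnegative and with \<open>- a\<close> otherwise.\<close>

lemma abs_g_ge:
  assumes "a \<in> int_floats t N" "0 \<le> a" "a \<le> \<bar>r\<bar>"
  shows "a \<le> \<bar>g r\<bar>"
  using g_nearest[of a r] g_nearest[of "- a" r] int_floats_uminus[OF assms(1)] assms
  by linarith

text \<open>Here \<open>2 ^ k\<close> is the spacing of the floats around \<open>r\<close> (the unit
  in the last place). The multiple of \<open>2 ^ k\<close> nearest to \<open>r\<close> is itself a
  float, so the error is at most half a unit. The case \<open>k = 0\<close> is the range in which
  all integers are floats.\<close>

lemma ulp_error: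
  assumes "\<bar>r\<bar> \<le> (2 ^ t - 1) * 2 ^ N"
  obtains k where "k \<le> N" "2 ^ k dvd g r" "2 * \<bar>g r - r\<bar> \<le> 2 ^ k" "\<bar>r\<bar> < 2 ^ (t + k)"
    "k = 0 \<or> 2 ^ (t + k) \<le> 2 * \<bar>r\<bar>"
proof -
  define k where "k = (LEAST k. \<bar>r\<bar> < 2 ^ (t + k))"
  have "(2 ^ t - 1) * 2 ^ N < (2 :: int) ^ (t + N)" by (simp add: power_add left_diff_distrib)
  then have N: "\<bar>r\<bar> < 2 ^ (t + N)" using assms by linarith
  have kN: "k \<le> N" unfolding k_def using N by (rule Least_le)
  have r_lt: "\<bar>r\<bar> < 2 ^ (t + k)" unfolding k_def using N by (rule LeastI)
  have r_ge: "2 ^ (t + k) \<le> 2 * \<bar>r\<bar>" if k0: "k \<noteq> 0"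
  proof -
    obtain l where l: "k = Suc l" using k0 not0_implies_Suc by blast
    then have "\<not> \<bar>r\<bar> < 2 ^ (t + l)" using not_less_Least[of l "\<lambda>k. \<bar>r\<bar> < 2 ^ (t + k)"] k_def by auto
    then show ?thesis using l by simp
  qed
  \<comment> \<open>With \<open>k = Suc l\<close>, the float \<open>2 ^ (t + l)\<close> does not
    exceed \<open>\<bar>r\<bar>\<close>, so \<open>\<bar>g r\<bar>\<close> reaches it; a float of
    that size can only be written with an exponent above \<open>l\<close>.\<close>
  have g_dvd: "2 ^ k dvd g r"
  proof (cases "k = 0")
    case False
    then obtain l where l: "k = Suc l" using not0_implies_Suc by blast
    have "2 ^ (t + l) \<in> int_floats t N" using l kN t_pos by (intro power_in_int_floats) auto
    then have "2 ^ (t + l) \<le> \<bar>g r\<bar>" using r_ge l by (intro abs_g_ge) auto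
    moreover obtain j where j: "2 ^ j dvd g r" "\<bar>g r\<bar> < 2 ^ (t + j)"
      using g_in int_floatsE by metis
    ultimately have "(2::int) ^ (t + l) < 2 ^ (t + j)" by linarith
    then have "k \<le> j" using l by simp
    then show ?thesis using j(1) power_le_dvd by blast
  qed simp
  have g_err: "2 * \<bar>g r - r\<bar> \<le> 2 ^ k"
  proof -
    define P where "P = (2::int) ^ k"
    have P: "P > 0" unfolding P_def by simp
    \<comment> \<open>\<open>c\<close> is the floor of \<open>r / P + 1 / 2\<close>, so
      \<open>P * c\<close> is a multiple of \<open>P\<close> nearest to \<open>r\<close>; it serves
      as competitor of \<open>g r\<close>.\<close>
    define c where "c = (2 * r + P) div (2 * P)"
    define q where "q = (2 * r + P) mod (2 * P)"
    have dm: "2 * P * c + q = 2 * r + P" unfolding c_def q_def by (rule mult_div_mod_eq)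
    have "2 * (P * c - r) = (2 * P * c + q) - (2 * r + q)" by (simp add: right_diff_distrib)
    also have "\<dots> = P - q" unfolding dm by simp
    finally have eq: "2 * (P * c - r) = P - q" .
    have "0 \<le> q" "q < 2 * P" unfolding q_def using P by simp_all
    then have err: "2 * \<bar>P * c - r\<bar> \<le> P"
      using eq by (smt (verit))
    have "\<bar>r\<bar> < P * 2 ^ t" using r_lt by (simp add: P_def power_add mult.commute)
    moreover have triangle: "\<bar>P * c\<bar> \<le> \<bar>r\<bar> + \<bar>P * c - r\<bar>"
      using abs_triangle_ineq[of r "P * c - r"] by simp
    ultimately have "2 * \<bar>P * c\<bar> < 2 * (P * 2 ^ t) + P" using err by (smt (verit))
    then have "2 * \<bar>P * c\<bar> < P * (2 * 2 ^ t + 1)" by (simp add: algebra_simps)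
    then have "P * (2 * \<bar>c\<bar>) < P * (2 * 2 ^ t + 1)" using P by (simp add: abs_mult)
    then have "2 * \<bar>c\<bar> < 2 * 2 ^ t + 1" using P by (simp only: mult_less_cancel_left_pos)
    then have c: "\<bar>c\<bar> \<le> 2 ^ t" by simp
    have "\<bar>P * c\<bar> \<le> (2 ^ t - 1) * 2 ^ N"
    \<comment> \<open>Rounding up to \<open>\<bar>c\<bar> = 2 ^ t\<close> carries into the next
      exponent. For \<open>k < N\<close> that exponent is available. For \<open>k = N\<close> the
      bound on \<open>r\<close> leaves a full unit below \<open>P * 2 ^ t\<close>, so the carry
      cannot occur.\<close>
    proof (cases "k = N")
      case True
      have "\<bar>r\<bar> \<le> P * 2 ^ t - P" using assms True by (simp add: P_def algebra_simps)
      then have "2 * \<bar>P * c\<bar> < 2 * (P * 2 ^ t)" using err P triangle by (smt (verit))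
      then have "2 * \<bar>P * c\<bar> < P * (2 * 2 ^ t)" by (simp add: algebra_simps)
      then have "P * (2 * \<bar>c\<bar>) < P * (2 * 2 ^ t)" using P by (simp add: abs_mult)
      then have "2 * \<bar>c\<bar> < 2 * 2 ^ t" using P by (simp only: mult_less_cancel_left_pos)
      then have "\<bar>c\<bar> \<le> 2 ^ t - 1" by simp
      then have "P * \<bar>c\<bar> \<le> P * (2 ^ t - 1)" using P by simp
      then show ?thesis using P True by (simp add: abs_mult P_def mult.commute)
    next
      case False
      then have "(2::int) ^ Suc k \<le> 2 ^ N" using kN by (intro power_increasing) auto
      then have N2: "2 * P \<le> 2 ^ N" by (simp add: P_def)
      have "(2::int) ^ 1 \<le> 2 ^ t" using t_pos by (intro power_increasing) auto
      then have t2: "(2::int) ^ t \<le> (2 ^ t - 1) * 2" by simp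
      have "\<bar>P * c\<bar> \<le> P * 2 ^ t" using c P by (simp add: abs_mult)
      also have "\<dots> \<le> P * ((2 ^ t - 1) * 2)" using t2 P by (simp only: mult_le_cancel_left_pos)
      also have "\<dots> = (2 ^ t - 1) * (2 * P)" by simp
      also have "\<dots> \<le> (2 ^ t - 1) * 2 ^ N" using N2 by (intro mult_left_mono) auto
      finally show ?thesis .
    qed
    moreover have "\<bar>P * c\<bar> \<le> 2 ^ (t + k)"
      using c P by (simp add: abs_mult power_add P_def mult.commute)
    ultimately have "P * c \<in> int_floats t N"
      by (intro int_floatsI_le[OF t_pos kN]) (auto simp: P_def)
    then show ?thesis using g_nearest[of "P * c" r] err by (simp add: P_def)
  qed
  show ?thesis using r_ge by (intro that[OF kN g_dvd g_err r_lt]) blast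
qed

lemma relative_error:
  assumes "\<bar>r\<bar> \<le> (2 ^ t - 1) * 2 ^ N"
  shows "2 ^ t * \<bar>g r - r\<bar> \<le> \<bar>r\<bar>"
proof -
  obtain k where k: "2 * \<bar>g r - r\<bar> \<le> 2 ^ k" "k = 0 \<or> 2 ^ (t + k) \<le> 2 * \<bar>r\<bar>"
    using ulp_error[OF assms] by metis
  show ?thesis
  proof (cases "k = 0")
    case True
    \<comment> \<open>Twice an integer is at most 1, so the rounding is exact: the bound stays
      purely relative even in the subnormal range.\<close>
    then have "2 * \<bar>g r - r\<bar> \<le> 1" using k by simp
    then have "\<bar>g r - r\<bar> = 0" by (smt (verit))
    then show ?thesis by simp
  next
    case False
    have "2 ^ t * (2 * \<bar>g r - r\<bar>) \<le> 2 ^ t * 2 ^ k" using k(1) by (intro mult_left_mono) auto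
    also have "\<dots> \<le> 2 * \<bar>r\<bar>" using k(2) False by (simp add: power_add)
    finally show ?thesis by simp
  qed
qed

text \<open>A multiple of \<open>2 ^ j\<close> below \<open>2 ^ (t + j)\<close> is a float. So an
  inexact rounding makes the spacing \<open>2 ^ k\<close> strictly coarser than the grid
  \<open>2 ^ j\<close> of the operands.\<close>

lemma inexact_exponent:
  assumes "j \<le> N" "2 ^ j dvd r" "g r \<noteq> r" "\<bar>r\<bar> < 2 ^ (t + k)"
  shows "j < k"
proof (rule ccontr)
  assume "\<not> j < k"
  then have "(2::int) ^ (t + k) \<le> 2 ^ (t + j)" by (intro power_increasing) auto
  then have "\<bar>r\<bar> < 2 ^ (t + j)" using assms(4) by linarith
  then have "r \<in> int_floats t N" using assms by (intro int_floatsI[of j])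
  then show False using g_id assms by blast
qed

text \<open>Let \<open>a\<close> be the summand with the finer grid. The error lies on that grid,
  and since \<open>b\<close> competes in the nearest rounding of \<open>a + b\<close>, the error is
  no larger than \<open>\<bar>a\<bar>\<close>.\<close>

lemma sum_error_in:
  assumes "a \<in> int_floats t N" "b \<in> int_floats t N" "\<bar>a + b\<bar> \<le> (2 ^ t - 1) * 2 ^ N"
  shows "a + b - g (a + b) \<in> int_floats t N"
  using assms
proof -
  have *: "a + b - g (a + b) \<in> int_floats t N"
    if ab: "\<bar>a + b\<bar> \<le> (2 ^ t - 1) * 2 ^ N" and b: "b \<in> int_floats t N"
      and i: "i \<le> N" "2 ^ i dvd a" "\<bar>a\<bar> < 2 ^ (t + i)" and bi: "2 ^ i dvd b" for a b i
  proof (cases "g (a + b) = a + b")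
    case True
    then show ?thesis by (auto intro: int_floatsI[of 0])
  next
    case False
    obtain k where k: "2 ^ k dvd g (a + b)" "\<bar>a + b\<bar> < 2 ^ (t + k)"
      using ulp_error[OF ab] by metis
    have "i < k" using inexact_exponent[OF i(1) _ False k(2)] i bi by auto
    then have "2 ^ i dvd g (a + b)" using k(1) power_le_dvd less_imp_le by blast
    moreover have "\<bar>a + b - g (a + b)\<bar> \<le> \<bar>a\<bar>" using g_nearest[OF b, of "a + b"] by linarith
    ultimately show ?thesis using i bi by (intro int_floatsI[of i]) auto
  qed
  obtain i where i: "i \<le> N" "2 ^ i dvd a" "\<bar>a\<bar> < 2 ^ (t + i)" using assms int_floatsE by metis
  obtain j where j: "j \<le> N" "2 ^ j dvd b" "\<bar>b\<bar> < 2 ^ (t + j)" using assms int_floatsE by metis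
  show ?thesis
  proof (cases "i \<le> j")
    case True
    then have "2 ^ i dvd b" using j power_le_dvd by blast
    then show ?thesis using *[OF assms(3,2) i] by simp
  next
    case False
    then have "2 ^ j dvd a" using i power_le_dvd nat_le_linear by blast
    then show ?thesis using *[of b a j] assms j by (simp add: add.commute)
  qed
qed

text \<open>If the larger number \<open>a\<close> came with the smaller exponent, then
  \<open>b\<close> is divisible by that power too and is small enough to be written with it. So
  exponents can be ordered like magnitudes.\<close>

lemma ordered_exponents:
  assumes "a \<in> int_floats t N" "b \<in> int_floats t N" "\<bar>b\<bar> \<le> \<bar>a\<bar>"
  obtains i j where "i \<le> N" "2 ^ i dvd a" "\<bar>a\<bar> < 2 ^ (t + i)"
    "j \<le> i" "2 ^ j dvd b" "\<bar>b\<bar> < 2 ^ (t + j)"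
proof -
  obtain i where i: "i \<le> N" "2 ^ i dvd a" "\<bar>a\<bar> < 2 ^ (t + i)" using assms int_floatsE by metis
  obtain j where j: "j \<le> N" "2 ^ j dvd b" "\<bar>b\<bar> < 2 ^ (t + j)" using assms int_floatsE by metis
  show ?thesis
  proof (cases "j \<le> i")
    case True
    then show ?thesis using that i j by blast
  next
    case False
    then have "2 ^ i dvd b" using j power_le_dvd nat_le_linear by blast
    then show ?thesis using that[of i i] i assms by auto
  qed
qed

section \<open>Exactness of the six-operation sum\<close>

text \<open>This is the exact subtraction in Dekker's fast two-sum. In the inexact case the
  difference is \<open>b\<close> plus a rounding error; both fit together on the grid common to
  \<open>a\<close> and \<open>g (a + b)\<close>.\<close>

lemma fast_sum_diff_in:
  assumes "a \<in> int_floats t N" "b \<in> int_floats t N" "\<bar>b\<bar> \<le> \<bar>a\<bar>"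
    and ov: "\<bar>a + b\<bar> \<le> (2 ^ t - 1) * 2 ^ N" "\<bar>g (a + b) - a\<bar> \<le> (2 ^ t - 1) * 2 ^ N"
  shows "g (a + b) - a \<in> int_floats t N"
proof (cases "g (a + b) = a + b")
  case True
  then show ?thesis using assms by simp
next
  case False
  obtain i j where i: "i \<le> N" "2 ^ i dvd a" "\<bar>a\<bar> < 2 ^ (t + i)"
    and j: "j \<le> i" "2 ^ j dvd b" "\<bar>b\<bar> < 2 ^ (t + j)"
    using ordered_exponents[OF assms(1-3)] by metis
  obtain k where k: "k \<le> N" "2 ^ k dvd g (a + b)" "2 * \<bar>g (a + b) - (a + b)\<bar> \<le> 2 ^ k"
    "\<bar>a + b\<bar> < 2 ^ (t + k)" "k = 0 \<or> 2 ^ (t + k) \<le> 2 * \<bar>a + b\<bar>"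
    using ulp_error[OF ov(1)] by metis
  have "2 ^ j dvd a" using i j power_le_dvd by blast
  then have "j < k" using inexact_exponent[of j "a + b" k] i j k False by auto
  then have "2 ^ (t + k) \<le> 2 * \<bar>a + b\<bar>" using k by auto
  also have "\<dots> \<le> 4 * \<bar>a\<bar>" using assms(3) by (smt (verit))
  also have "\<dots> < 4 * 2 ^ (t + i)" using i(3) by simp
  also have "\<dots> = 2 ^ (t + i + 2)" by (simp add: power_add)
  finally have "t + k < t + i + 2" by (simp only: power_strict_increasing_iff[of "2::int"])
  then have ki: "k \<le> i + 1" by simp
  \<comment> \<open>\<open>2 ^ l\<close> divides both \<open>a\<close> and the rounded sum. Since
    \<open>k\<close> exceeds \<open>l\<close> by at most one, the half-unit error is at most
    \<open>2 ^ l\<close>.\<close>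
  define l where "l = min k i"
  have l: "2 ^ l dvd a" "2 ^ l dvd g (a + b)" "l \<le> N" "j \<le> l" "k \<le> Suc l"
    using i k \<open>j < k\<close> j ki power_le_dvd[of 2 i a l] power_le_dvd[of 2 k "g (a + b)" l]
    unfolding l_def by auto
  have "(2::int) ^ k \<le> 2 ^ Suc l" using l by (intro power_increasing) auto
  then have err: "\<bar>g (a + b) - (a + b)\<bar> \<le> 2 ^ l" using k by simp
  obtain m where m: "b = 2 ^ j * m" using j by (metis dvd_def)
  then have "\<bar>m\<bar> < 2 ^ t" using j by (simp add: abs_mult power_add mult.commute)
  \<comment> \<open>Integrality of the mantissa leaves exactly the room \<open>2 ^ l\<close> that
    the rounding error needs below \<open>2 ^ (t + l)\<close>.\<close>
  then have "\<bar>m\<bar> \<le> 2 ^ t - 1" by simp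
  then have "\<bar>b\<bar> \<le> 2 ^ j * (2 ^ t - 1)" using m by (simp add: abs_mult)
  also have "\<dots> \<le> 2 ^ l * (2 ^ t - 1)" using l by (intro mult_right_mono power_increasing) auto
  finally have "\<bar>g (a + b) - a\<bar> \<le> 2 ^ (t + l)" using err
    by (simp add: power_add algebra_simps)
  then show ?thesis using l ov by (intro int_floatsI_le[OF t_pos, of l]) auto
qed

text \<open>\<open>b - b'\<close> is the sum of the errors committed in \<open>s\<close> and in
  \<open>b'\<close>. If one of them vanishes the claim reduces to zero or to
  \<open>sum_error_in\<close>. Otherwise both half units are compared with the grid common to
  \<open>b\<close> and \<open>b'\<close>.\<close>

lemma recovered_summand_error_in:
  assumes a: "a \<in> int_floats t N" and b: "b \<in> int_floats t N" and ab: "\<bar>a\<bar> < \<bar>b\<bar>"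
    and ov: "\<bar>a + b\<bar> \<le> (2 ^ t - 1) * 2 ^ N" "\<bar>g (a + b) - a\<bar> \<le> (2 ^ t - 1) * 2 ^ N"
    "\<bar>b - g (g (a + b) - a)\<bar> \<le> (2 ^ t - 1) * 2 ^ N"
  shows "b - g (g (a + b) - a) \<in> int_floats t N"
proof -
  define s where "s = g (a + b)"
  define b' where "b' = g (s - a)"
  obtain j i where j: "j \<le> N" "2 ^ j dvd b" "\<bar>b\<bar> < 2 ^ (t + j)"
    and i: "i \<le> j" "2 ^ i dvd a" "\<bar>a\<bar> < 2 ^ (t + i)"
    using ordered_exponents[OF b a] ab by (metis less_imp_le)
  consider "s = a + b" | "b' = s - a" | "s \<noteq> a + b" "b' \<noteq> s - a" by blast
  then have "b - b' \<in> int_floats t N"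
  proof cases
    case 1
    then have "b' = b" using g_id[OF b] b'_def by simp
    then show ?thesis by (auto intro: int_floatsI[of 0])
  next
    case 2
    then have "b - b' = a + b - g (a + b)" unfolding s_def by simp
    then show ?thesis using sum_error_in[OF a b ov(1)] by (simp only:)
  next
    case 3
    obtain k where k: "k \<le> N" "2 ^ k dvd s" "2 * \<bar>s - (a + b)\<bar> \<le> 2 ^ k"
      "\<bar>a + b\<bar> < 2 ^ (t + k)" "k = 0 \<or> 2 ^ (t + k) \<le> 2 * \<bar>a + b\<bar>"
      using ulp_error[OF ov(1)] s_def by metis
    obtain l where l: "l \<le> N" "2 ^ l dvd b'" "2 * \<bar>b' - (s - a)\<bar> \<le> 2 ^ l"
      "\<bar>s - a\<bar> < 2 ^ (t + l)" "l = 0 \<or> 2 ^ (t + l) \<le> 2 * \<bar>s - a\<bar>"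
      using ulp_error[OF ov(2)] s_def b'_def by metis
    have "2 ^ i dvd b" using i j power_le_dvd by blast
    then have ik: "i < k" using inexact_exponent[of i "a + b" k] i j k 3 s_def by auto
    then have "2 ^ i dvd s" using k power_le_dvd less_imp_le by blast
    then have il: "i < l" using inexact_exponent[of i "s - a" l] i j l 3 b'_def by auto
    have k2: "2 ^ (t + k) \<le> 2 * \<bar>a + b\<bar>" using ik k by auto
    have l2: "2 ^ (t + l) \<le> 2 * \<bar>s - a\<bar>" using il l by auto
    have "2 * \<bar>a + b\<bar> < 4 * \<bar>b\<bar>" using ab by (smt (verit))
    then have "2 ^ (t + k) < 4 * \<bar>b\<bar>" using k2 by (smt (verit))
    also have "\<dots> < 2 ^ (t + j + 2)" using j by (simp add: power_add)
    finally have "t + k < t + j + 2" by (simp only: power_strict_increasing_iff[of "2::int"])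
    then have kj: "k \<le> Suc j" by simp
    have total: "2 * \<bar>b - b'\<bar> \<le> 2 ^ k + 2 ^ l" using k(3) l(3) by (smt (verit))
    \<comment> \<open>\<open>k\<close> and \<open>l\<close> are the exponents of \<open>s\<close> and \<open>b'\<close>. Were \<open>l\<close> smaller than \<open>k - t\<close>, then \<open>b\<close> would be
      below \<open>2 ^ k\<close>, too small for the sum with \<open>a\<close> to reach exponent \<open>k\<close>.\<close>
    have ktl: "k \<le> t + l"
    proof (rule ccontr)
      assume "\<not> k \<le> t + l"
      then have "(2::int) ^ Suc (t + l) \<le> 2 ^ k" by (intro power_increasing) auto
      then have "2 * \<bar>s - a\<bar> < 2 ^ k" using l(4) by simp
      then have bk: "\<bar>b\<bar> < 2 ^ k" using k(3) by (smt (verit))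
      then have "2 ^ (t + k) < 4 * (2::int) ^ k" using k2 ab by (smt (verit))
      also have "\<dots> = 2 ^ (2 + k)" by simp
      finally have "t + k < 2 + k" by (simp only: power_strict_increasing_iff[of "2::int"])
      then have t: "t = 1" using t_pos by simp
      \<comment> \<open>For \<open>t = 1\<close> the strict bound on \<open>b\<close> is not yet
        contradictory. Nonzero one-digit floats are signed powers of two, so
        \<open>\<bar>b\<bar> < 2 ^ k\<close> improves by a factor of two.\<close>
      have "2 * \<bar>b\<bar> \<le> 2 ^ k"
      proof -
        obtain m p where m: "b = m * 2 ^ p" "\<bar>m\<bar> < 2"
          using b t unfolding int_floats_def by auto
        have "\<bar>b\<bar> = 2 ^ p" using m ab by (cases "m = 0") (auto simp: abs_mult)
        moreover from this bk have "p < k" by simp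
        then have "(2::int) ^ Suc p \<le> 2 ^ k" by (intro power_increasing) auto
        ultimately show ?thesis by simp
      qed
      then show False using k2 t ab by simp
    qed
    show ?thesis
    \<comment> \<open>The common grid of \<open>b\<close> and \<open>b'\<close> is
      \<open>2 ^ l\<close> or \<open>2 ^ j\<close>. On the first the bound
      \<open>k \<le> t + l\<close> suffices; on the second both \<open>k\<close> and
      \<open>l\<close> are at most \<open>Suc j\<close>, and \<open>t\<close> is at least 1.\<close>
    proof (cases "l \<le> j")
      case True
      then have "2 ^ l dvd b" using j power_le_dvd by blast
      have "(2::int) ^ k \<le> 2 ^ (t + l)" "(2::int) ^ l \<le> 2 ^ (t + l)"
        using ktl by (auto intro: power_increasing)
      then have "\<bar>b - b'\<bar> \<le> 2 ^ (t + l)" using total by (smt (verit))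
      then show ?thesis using ov(3) l \<open>2 ^ l dvd b\<close> unfolding b'_def s_def
        by (intro int_floatsI_le[OF t_pos, of l]) auto
    next
      case False
      have kj2: "(2::int) ^ k \<le> 2 ^ Suc j" using kj by (intro power_increasing) auto
      have "(2::int) ^ j \<le> 2 ^ (t + j)" by (intro power_increasing) auto
      moreover have "2 ^ k \<le> 2 * (2::int) ^ j" using kj2 by simp
      moreover have "2 * \<bar>s - a\<bar> \<le> 2 * \<bar>s - (a + b)\<bar> + 2 * \<bar>b\<bar>" by (smt (verit))
      ultimately have "2 * \<bar>s - a\<bar> < 4 * 2 ^ (t + j)" using k(3) j(3) by (smt (verit))
      with l2 have "(2::int) ^ (t + l) < 4 * 2 ^ (t + j)" by (rule le_less_trans)
      also have "\<dots> = 2 ^ (t + j + 2)" by (simp add: power_add)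
      finally have "t + l < t + j + 2" by (simp only: power_strict_increasing_iff[of "2::int"])
      then have "(2::int) ^ l \<le> 2 ^ Suc j" by (intro power_increasing) auto
      then have "\<bar>b - b'\<bar> \<le> 2 ^ Suc j" using total kj2 by (smt (verit))
      also have "(2::int) ^ Suc j \<le> 2 ^ (t + j)" using t_pos by (intro power_increasing) auto
      finally have "\<bar>b - b'\<bar> \<le> 2 ^ (t + j)" .
      moreover have "2 ^ j dvd b'" using l False power_le_dvd nat_le_linear by blast
      ultimately show ?thesis using ov(3) j unfolding b'_def s_def
        by (intro int_floatsI_le[OF t_pos, of j]) auto
    qed
  qed
  then show ?thesis unfolding b'_def s_def .
qed

text \<open>A case of Sterbenz's lemma: under cancellation the sum lies on the finer grid of
  \<open>a\<close> and is no larger than \<open>a\<close>.\<close>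

lemma abs_sum_small_in:
  assumes "a \<in> int_floats t N" "b \<in> int_floats t N" "\<bar>a\<bar> \<le> \<bar>b\<bar>" "\<bar>a + b\<bar> \<le> \<bar>a\<bar>"
  shows "a + b \<in> int_floats t N"
proof -
  obtain j i where j: "j \<le> N" "2 ^ j dvd b"
    and i: "i \<le> j" "2 ^ i dvd a" "\<bar>a\<bar> < 2 ^ (t + i)"
    using ordered_exponents[OF assms(2,1,3)] by metis
  then have "2 ^ i dvd b" using power_le_dvd by blast
  then show ?thesis using i j assms(4) by (intro int_floatsI[of i]) auto
qed

text \<open>The names \<open>s\<close>, \<open>b'\<close>, \<open>d\<close>, \<open>v\<close>,
  \<open>c\<close> stand for \<open>z\<close>, \<open>w\<close>, \<open>z1\<close>,
  \<open>v\<close>, \<open>z2\<close> in \<open>add6\<close>. It suffices that \<open>d + c\<close>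
  equals the rounding error before the last rounding, because that error is a float.\<close>

lemma two_sum_exact:
  assumes a: "a \<in> int_floats t N" and b: "b \<in> int_floats t N"
    and s: "s = g (a + b)" and b': "b' = g (s - a)" and d: "d = g (b - b')"
    and v: "v = g (b' - s)" and c: "c = g (a + v)"
    and ov: "\<bar>a + b\<bar> \<le> B" "\<bar>s - a\<bar> \<le> B" "\<bar>b - b'\<bar> \<le> B" "\<bar>b' - s\<bar> \<le> B"
    and B: "B = (2 ^ t - 1) * 2 ^ N"
  shows "g (d + c) = a + b - s"
proof -
  have zero: "0 \<in> int_floats t N" by (auto intro: int_floatsI[of 0])
  have err: "a + b - s \<in> int_floats t N" using sum_error_in a b ov s B by simp
  have "d + c = a + b - s"
  proof (cases "\<bar>b\<bar> \<le> \<bar>a\<bar>")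
    case True
    then have "s - a \<in> int_floats t N" using fast_sum_diff_in[OF a b] ov s B by simp
    then have 1: "b' = s - a" using g_id b' by simp
    then have "b - b' = a + b - s" by simp
    then have "d = a + b - s" using g_id[OF err] d by (simp only:)
    moreover have "v = - a" using 1 v g_id[OF int_floats_uminus[OF a]] by simp
    then have "c = 0" using c g_id[OF zero] by simp
    ultimately show ?thesis by simp
  next
    case False
    show ?thesis
    proof (cases "\<bar>a + b\<bar> \<le> \<bar>a\<bar>")
      case True
      then have "s = a + b" using abs_sum_small_in[OF a b] False g_id s by simp
      moreover from this have "b' = b" using b' g_id[OF b] by simp
      moreover from calculation have "d = 0" using d g_id[OF zero] by simp
      moreover from calculation have "v = - a" using v g_id[OF int_floats_uminus[OF a]] by simp
      then have "c = 0" using c g_id[OF zero] by simp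
      ultimately show ?thesis by simp
    next
      case as: False
      \<comment> \<open>Rounding cannot take the sum below the float \<open>\<bar>a\<bar>\<close>,
        so \<open>s\<close> dominates \<open>- a\<close>, as the fast two-sum of these two
        requires.\<close>
      have "\<bar>a\<bar> \<in> int_floats t N" using a int_floats_uminus by (simp add: abs_if)
      then have "\<bar>a\<bar> \<le> \<bar>s\<bar>" using as unfolding s by (intro abs_g_ge) auto
      moreover have sF: "s \<in> int_floats t N" using s g_in by simp
      note na = int_floats_uminus[OF a]
      \<comment> \<open>\<open>b'\<close>, \<open>v\<close>, \<open>c\<close> are the three operations of the fast two-sum of \<open>s\<close> and \<open>- a\<close>.\<close>
      ultimately have "b' - s \<in> int_floats t N"
        using fast_sum_diff_in[OF sF na] ov b' B by simp
      then have v': "v = b' - s" using v g_id by simp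
      have "s - a - b' \<in> int_floats t N" using sum_error_in[OF sF na] ov b' B by simp
      moreover have "a + v = - (s - a - b')" using v' by simp
      ultimately have "a + v \<in> int_floats t N" using int_floats_uminus by metis
      then have "c = a + v" using c g_id by simp
      moreover have "b - b' \<in> int_floats t N"
        using recovered_summand_error_in[OF a b] False ov s b' B by simp
      then have "d = b - b'" using d g_id by simp
      ultimately show ?thesis using v' by simp
    qed
  qed
  then show ?thesis using g_id[OF err] by simp
qed

end

section \<open>Transfer from integers to real floating point numbers\<close>

lemma powi_shift:
  assumes "Emin \<le> e"
  shows "(2::real) powi e = 2 powi Emin * 2 ^ nat (e - Emin)"
proof -
  obtain k where "e = Emin + int k" using assms zle_iff_zadd by auto
  then show ?thesis by (simp add: power_int_add)
qed

lemma dekker_floats_eq_scaled_int_floats: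
  assumes "Emin \<le> Emax"
  shows "dekker_floats t Emin Emax =
    (\<lambda>k. of_int k * 2 powi Emin) ` int_floats t (nat (Emax - Emin))" (is "?L = ?R")
proof
  show "?L \<subseteq> ?R"
  proof
    fix x assume "x \<in> ?L"
    then obtain m e where m: "x = of_int m * 2 powi e" "\<bar>m\<bar> < 2 ^ t" "Emin \<le> e" "e \<le> Emax"
      unfolding dekker_floats_def by auto
    have "x = of_int (m * 2 ^ nat (e - Emin)) * 2 powi Emin"
      using m powi_shift[OF m(3)] by simp
    moreover have "m * 2 ^ nat (e - Emin) \<in> int_floats t (nat (Emax - Emin))"
      using m(2-4) unfolding int_floats_def by (auto intro!: exI[of _ m])
    ultimately show "x \<in> ?R" by blast
  qed
next
  show "?R \<subseteq> ?L"
  proof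
    fix x assume "x \<in> ?R"
    then obtain m j where m: "x = of_int (m * 2 ^ j) * 2 powi Emin" "\<bar>m\<bar> < 2 ^ t"
      "j \<le> nat (Emax - Emin)"
      unfolding int_floats_def by auto
    have "x = of_int m * 2 powi (Emin + int j)" using m by (simp add: power_int_add)
    moreover have "Emin \<le> Emin + int j" "Emin + int j \<le> Emax" using m assms by auto
    ultimately show "x \<in> ?L" using m(2) unfolding dekker_floats_def by blast
  qed
qed

lemma max_float_eq_scaled:
  assumes "Emin \<le> Emax"
  shows "max_float t Emax = of_int ((2 ^ t - 1) * 2 ^ nat (Emax - Emin)) * 2 powi Emin"
  unfolding max_float_def powi_shift[OF assms] by simp

text \<open>Sums and differences of floats stay in the lattice of integer multiples of
  \<open>2 powi Emin\<close>. All floats lie in this lattice, so \<open>fl\<close> restricts to it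
  and the restriction is again a nearest rounding.\<close>

lemma nearest_rounding_scaled:
  assumes "t \<ge> 1" "Emin \<le> Emax" "nearest_rounding (dekker_floats t Emin Emax) fl"
  obtains g where "int_rounding t (nat (Emax - Emin)) g"
    "\<And>k. fl (of_int k * 2 powi Emin) = of_int (g k) * 2 powi Emin"
proof -
  define \<mu> :: real where "\<mu> = 2 powi Emin"
  define N where "N = nat (Emax - Emin)"
  have \<mu>: "\<mu> > 0" unfolding \<mu>_def by simp
  have D: "dekker_floats t Emin Emax = (\<lambda>k. of_int k * \<mu>) ` int_floats t N"
    unfolding \<mu>_def N_def using dekker_floats_eq_scaled_int_floats assms by blast
  have "\<forall>k. \<exists>m. fl (of_int k * \<mu>) = of_int m * \<mu> \<and> m \<in> int_floats t N"
    using assms(3) D unfolding nearest_rounding_def by blast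
  then obtain g where g: "\<And>k. fl (of_int k * \<mu>) = of_int (g k) * \<mu>"
    "\<And>k. g k \<in> int_floats t N"
    by metis
  have "\<bar>g r - r\<bar> \<le> \<bar>a - r\<bar>" if "a \<in> int_floats t N" for a r
  proof -
    have "\<bar>fl (of_int r * \<mu>) - of_int r * \<mu>\<bar> \<le> \<bar>of_int a * \<mu> - of_int r * \<mu>\<bar>"
      using assms(3) that unfolding nearest_rounding_def D by blast
    then have "of_int \<bar>g r - r\<bar> * \<mu> \<le> of_int \<bar>a - r\<bar> * \<mu>"
      using \<mu> by (simp add: g left_diff_distrib[symmetric] abs_mult)
    then have "real_of_int \<bar>g r - r\<bar> \<le> of_int \<bar>a - r\<bar>" using \<mu> by (simp only: mult_le_cancel_right_pos)
    then show ?thesis by (simp only: of_int_le_iff)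
  qed
  then have "int_rounding t N g" using assms(1) g(2) by unfold_locales auto
  then show ?thesis using that g(1) unfolding \<mu>_def N_def by blast
qed

lemma unit_roundoff_eq: "unit_roundoff t = 1 / 2 ^ t"
  unfolding unit_roundoff_def by (simp add: power_int_diff)

text \<open>The argument is a sum of two floats, hence an integer multiple of
  \<open>2 powi Emin\<close>; this is why no absolute underflow term appears.\<close>

lemma fl_relative_error:
  assumes "t \<ge> 1" "Emin \<le> Emax" "nearest_rounding (dekker_floats t Emin Emax) fl"
    and "x \<in> dekker_floats t Emin Emax" "y \<in> dekker_floats t Emin Emax"
    and ov: "\<bar>x + y\<bar> \<le> max_float t Emax"
  shows "\<bar>fl (x + y) - (x + y)\<bar> \<le> unit_roundoff t * \<bar>x + y\<bar>"
proof -
  define \<mu> :: real where "\<mu> = 2 powi Emin"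
  have \<mu>: "\<mu> > 0" unfolding \<mu>_def by simp
  obtain g where g: "int_rounding t (nat (Emax - Emin)) g"
    "\<And>k. fl (of_int k * \<mu>) = of_int (g k) * \<mu>"
    using nearest_rounding_scaled[OF assms(1-3)] unfolding \<mu>_def by metis
  obtain a b where "x = of_int a * \<mu>" "y = of_int b * \<mu>"
    using assms(4,5) dekker_floats_eq_scaled_int_floats[OF assms(2)] unfolding \<mu>_def by auto
  then have xy: "x + y = of_int (a + b) * \<mu>" by (simp add: distrib_right)
  have "of_int \<bar>a + b\<bar> * \<mu> \<le> of_int ((2 ^ t - 1) * 2 ^ nat (Emax - Emin)) * \<mu>"
    using ov \<mu> unfolding xy max_float_eq_scaled[OF assms(2)] \<mu>_def[symmetric]
    by (simp only: abs_mult of_int_abs abs_of_pos)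
  then have "\<bar>a + b\<bar> \<le> (2 ^ t - 1) * 2 ^ nat (Emax - Emin)"
    using \<mu> by (simp only: mult_le_cancel_right_pos of_int_le_iff)
  then have "2 ^ t * \<bar>g (a + b) - (a + b)\<bar> \<le> \<bar>a + b\<bar>"
    using int_rounding.relative_error[OF g(1)] by blast
  then have "real_of_int (2 ^ t * \<bar>g (a + b) - (a + b)\<bar>) \<le> of_int \<bar>a + b\<bar>"
    by (simp only: of_int_le_iff)
  then have "2 ^ t * \<bar>of_int (g (a + b)) - of_int (a + b)\<bar> * \<mu> \<le> \<bar>of_int (a + b)\<bar> * \<mu>"
    using \<mu> by simp
  moreover have "fl (x + y) - (x + y) = (of_int (g (a + b)) - of_int (a + b)) * \<mu>"
    unfolding xy g(2) by (simp add: algebra_simps)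
  ultimately have "2 ^ t * \<bar>fl (x + y) - (x + y)\<bar> \<le> \<bar>x + y\<bar>"
    unfolding xy using \<mu> by (simp add: abs_mult mult.assoc)
  then show ?thesis unfolding unit_roundoff_eq by (simp add: field_simps)
qed

lemma add6_exact:
  assumes "t \<ge> 1" "Emin \<le> Emax" and near: "nearest_rounding (dekker_floats t Emin Emax) fl"
    and x: "x \<in> dekker_floats t Emin Emax" and y: "y \<in> dekker_floats t Emin Emax"
    and ov: "add6_no_overflow fl (max_float t Emax) x y"
    and z: "(z, zz) = add6 fl x y"
  shows "z + zz = x + y"
    and "\<bar>z - (x + y)\<bar> \<le> unit_roundoff t * \<bar>x + y\<bar>"
    and "z \<in> dekker_floats t Emin Emax" and "zz \<in> dekker_floats t Emin Emax"
proof -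
  define \<mu> :: real where "\<mu> = 2 powi Emin"
  define B where "B = (2 ^ t - 1 :: int) * 2 ^ nat (Emax - Emin)"
  have \<mu>: "\<mu> > 0" unfolding \<mu>_def by simp
  obtain g where g: "int_rounding t (nat (Emax - Emin)) g"
    "\<And>k. fl (of_int k * \<mu>) = of_int (g k) * \<mu>"
    using nearest_rounding_scaled[OF assms(1-3)] unfolding \<mu>_def by metis
  \<comment> \<open>\<open>sc\<close> and \<open>le\<close> serve as rewrite rules that turn each
    operation of \<open>add6\<close> and each overflow bound into its integer counterpart.\<close>
  have sc: "of_int k * \<mu> + of_int l * \<mu> = of_int (k + l) * \<mu>"
    "of_int k * \<mu> - of_int l * \<mu> = of_int (k - l) * \<mu>" for k l
    by (simp_all add: algebra_simps)
  have le: "\<bar>of_int k * \<mu>\<bar> \<le> of_int B * \<mu> \<longleftrightarrow> \<bar>k\<bar> \<le> B" for k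
  proof -
    have "\<bar>of_int k * \<mu>\<bar> = of_int \<bar>k\<bar> * \<mu>" using \<mu> by (simp add: abs_mult)
    then show ?thesis using \<mu> by (simp only: mult_le_cancel_right_pos of_int_le_iff)
  qed
  obtain a b where a: "x = of_int a * \<mu>" "a \<in> int_floats t (nat (Emax - Emin))"
    and b: "y = of_int b * \<mu>" "b \<in> int_floats t (nat (Emax - Emin))"
    using x y dekker_floats_eq_scaled_int_floats[OF assms(2)] unfolding \<mu>_def by auto
  define s where "s = g (a + b)"
  define w where "w = g (s - a)"
  define d where "d = g (b - w)"
  define v where "v = g (w - s)"
  define c where "c = g (a + v)"
  have max: "max_float t Emax = of_int B * \<mu>"
    unfolding B_def \<mu>_def by (rule max_float_eq_scaled[OF assms(2)])
  have zs: "z = of_int s * \<mu>" "zz = of_int (g (d + c)) * \<mu>"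
    using z unfolding add6_def Let_def a(1) b(1) sc g(2) s_def w_def d_def v_def c_def
    by simp_all
  have ovs: "\<bar>a + b\<bar> \<le> B" "\<bar>s - a\<bar> \<le> B" "\<bar>b - w\<bar> \<le> B" "\<bar>w - s\<bar> \<le> B"
    using ov unfolding add6_no_overflow_def Let_def max a(1) b(1) sc g(2) le
      s_def w_def d_def v_def c_def
    by simp_all
  have "g (d + c) = a + b - s"
    by (rule int_rounding.two_sum_exact[OF g(1) a(2) b(2) s_def w_def d_def v_def c_def ovs B_def])
  then have "s + g (d + c) = a + b" by simp
  then show "z + zz = x + y" unfolding zs a(1) b(1) sc by (simp only:)
  have z_eq: "z = fl (x + y)" using z unfolding add6_def Let_def by simp
  have "\<bar>x + y\<bar> \<le> max_float t Emax" using ov unfolding add6_no_overflow_def Let_def by simp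
  then show "\<bar>z - (x + y)\<bar> \<le> unit_roundoff t * \<bar>x + y\<bar>"
    unfolding z_eq using fl_relative_error[OF assms(1-5)] by simp
  show "z \<in> dekker_floats t Emin Emax" "zz \<in> dekker_floats t Emin Emax"
    using z near unfolding add6_def Let_def nearest_rounding_def by simp_all
qed

section \<open>Relative perturbations and perturbed linear recurrences\<close>

definition rel_dev :: "real \<Rightarrow> real \<Rightarrow> real" where
  "rel_dev z r = (if r = 0 then 0 else z / r - 1)"

text \<open>For \<open>r = 0\<close> the hypothesis forces \<open>z = 0\<close>, so the default
  deviation 0 is correct there.\<close>

lemma rel_dev:
  assumes "\<bar>z - r\<bar> \<le> \<epsilon> * \<bar>r\<bar>" "\<epsilon> \<ge> 0"
  shows "\<bar>rel_dev z r\<bar> \<le> \<epsilon>" "z = (1 + rel_dev z r) * r"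
proof -
  have "rel_dev z r = (z - r) / r" unfolding rel_dev_def by (simp add: diff_divide_distrib)
  then have "\<bar>rel_dev z r\<bar> = \<bar>z - r\<bar> / \<bar>r\<bar>" by (simp only: abs_divide)
  then show "\<bar>rel_dev z r\<bar> \<le> \<epsilon>"
    using assms by (cases "r = 0") (simp_all add: pos_divide_le_eq)
  show "z = (1 + rel_dev z r) * r" unfolding rel_dev_def using assms by auto
qed

text \<open>A Bernoulli-type estimate, by induction on its form without division: passing from
  \<open>m\<close> to \<open>Suc m\<close> loses only the nonnegative amount
  \<open>real (Suc m) * \<sigma>\<^sup>2\<close>. It produces the denominators of the final
  bounds.\<close>

lemma power_one_plus_le:
  fixes \<sigma> :: real
  assumes "\<sigma> \<ge> 0" "real m * \<sigma> < 1"
  shows "(1 + \<sigma>) ^ m \<le> 1 / (1 - real m * \<sigma>)"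
proof -
  have "(1 - real m * \<sigma>) * (1 + \<sigma>) ^ m \<le> 1" using assms(2)
  proof (induction m)
    case (Suc m)
    have m: "real m * \<sigma> < 1" using Suc.prems assms(1) by (simp add: distrib_right)
    have "(1 - real (Suc m) * \<sigma>) * (1 + \<sigma>) = (1 - real m * \<sigma>) - real (Suc m) * \<sigma>\<^sup>2"
      by (simp add: algebra_simps power2_eq_square)
    also have "\<dots> \<le> 1 - real m * \<sigma>" by simp
    finally have "(1 - real (Suc m) * \<sigma>) * (1 + \<sigma>) * (1 + \<sigma>) ^ m \<le> (1 - real m * \<sigma>) * (1 + \<sigma>) ^ m"
      using assms(1) by (intro mult_right_mono) auto
    then show ?case using Suc.IH[OF m] by (simp add: mult.assoc)
  qed simp
  then show ?thesis using assms by (simp add: pos_le_divide_eq mult.commute)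
qed

text \<open>The extreme case has every factor equal to \<open>1 + \<sigma>\<close>. The induction
  splits \<open>f i * p - 1\<close> into \<open>f i * (p - 1)\<close> and \<open>f i - 1\<close>,
  where \<open>p\<close> is the product over \<open>A\<close>.\<close>

lemma abs_prod_minus_one_le:
  fixes f :: "'a \<Rightarrow> real"
  assumes "finite A" "\<sigma> \<ge> 0" "\<And>i. i \<in> A \<Longrightarrow> \<bar>f i - 1\<bar> \<le> \<sigma>"
  shows "\<bar>prod f A - 1\<bar> \<le> (1 + \<sigma>) ^ card A - 1"
  using assms(1,3)
proof (induction A rule: finite_induct)
  case (insert i A)
  have IH: "\<bar>prod f A - 1\<bar> \<le> (1 + \<sigma>) ^ card A - 1" using insert by auto
  have "\<bar>f i\<bar> \<le> 1 + \<sigma>" using insert.prems[of i] by auto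
  then have "\<bar>f i\<bar> * \<bar>prod f A - 1\<bar> \<le> (1 + \<sigma>) * ((1 + \<sigma>) ^ card A - 1)"
    using IH assms(2) by (intro mult_mono) auto
  moreover have "prod f (insert i A) - 1 = f i * (prod f A - 1) + (f i - 1)"
    using insert by (simp add: algebra_simps)
  moreover have "\<bar>f i - 1\<bar> \<le> \<sigma>" using insert.prems by auto
  ultimately have "\<bar>prod f (insert i A) - 1\<bar> \<le> (1 + \<sigma>) * ((1 + \<sigma>) ^ card A - 1) + \<sigma>"
    using abs_triangle_ineq[of "f i * (prod f A - 1)" "f i - 1"] by (simp add: abs_mult)
  then show ?case using insert by (simp add: algebra_simps)
qed simp

lemma linear_recurrence_solution:
  fixes S P c :: "nat \<Rightarrow> 'a::comm_ring_1"
  assumes "S 0 = 0" "\<And>i. i \<in> {1..n} \<Longrightarrow> S i = P i * S (i - 1) + c i"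
  shows "S n = (\<Sum>k=1..n. (\<Prod>i=k+1..n. P i) * c k)"
  using assms(2)
proof (induction n)
  case (Suc n)
  have "S (Suc n) = P (Suc n) * S n + c (Suc n)" using Suc.prems[of "Suc n"] by simp
  also have "S n = (\<Sum>k=1..n. (\<Prod>i=k+1..n. P i) * c k)" using Suc by auto
  also have "P (Suc n) * \<dots> = (\<Sum>k=1..n. (\<Prod>i=k+1..Suc n. P i) * c k)"
    unfolding sum_distrib_left by (intro sum.cong) (auto simp: mult_ac)
  \<comment> \<open>The remaining term \<open>c (Suc n)\<close> is the summand
    \<open>k = Suc n\<close>, whose product is empty.\<close>
  finally show ?case by simp
qed (simp add: assms(1))

lemma abs_triangle_ineq_three:
  fixes a b c :: "'a::ordered_ab_group_add_abs"
  shows "\<bar>a + b + c\<bar> \<le> \<bar>a\<bar> + \<bar>b\<bar> + \<bar>c\<bar>"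
  by (meson abs_triangle_ineq add_right_mono order_trans)

text \<open>With \<open>p\<close> the product in front of \<open>c k\<close>, the three terms of the
  bound come from \<open>p * c k - 1 = (c k - 1) + (p - 1) + (p - 1) * (c k - 1)\<close>.\<close>

lemma perturbed_sum_bound:
  fixes P c x :: "nat \<Rightarrow> real"
  assumes "n \<ge> 1" "\<sigma> \<ge> 0" "\<tau> \<ge> 0" "(real n - 1) * \<sigma> < 1"
    and P: "\<And>i. i \<in> {1..n} \<Longrightarrow> \<bar>P i - 1\<bar> \<le> \<sigma>"
    and c: "\<And>i. i \<in> {1..n} \<Longrightarrow> \<bar>c i - 1\<bar> \<le> \<tau>"
  shows "\<bar>(\<Sum>k=1..n. (\<Prod>i=k+1..n. P i) * c k * x k) - (\<Sum>k=1..n. x k)\<bar>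
    \<le> \<tau> * (\<Sum>k=1..n. \<bar>x k\<bar>)
      + (real n - 1) * \<sigma> / (1 - (real n - 1) * \<sigma>) * (\<Sum>k=1..n. \<bar>x k\<bar>)
      + (real n - 1) * \<sigma> * \<tau> / (1 - (real n - 1) * \<sigma>) * (\<Sum>k=1..n. \<bar>x k\<bar>)"
proof -
  define d where "d = (real n - 1) * \<sigma> / (1 - (real n - 1) * \<sigma>)"
  have n1: "real (n - 1) = real n - 1" using assms(1) by simp
  have "1 / (1 - (real n - 1) * \<sigma>) - 1 = d" unfolding d_def using assms(4) by (simp add: field_simps)
  then have pow: "(1 + \<sigma>) ^ (n - 1) - 1 \<le> d"
    using power_one_plus_le[of \<sigma> "n - 1"] assms n1 by simp
  have each: "\<bar>(\<Prod>i=k+1..n. P i) * c k * x k - x k\<bar> \<le> (\<tau> + d + d * \<tau>) * \<bar>x k\<bar>"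
    if k: "k \<in> {1..n}" for k
  proof -
    define p where "p = (\<Prod>i=k+1..n. P i)"
    have "\<bar>p - 1\<bar> \<le> (1 + \<sigma>) ^ card {k+1..n} - 1"
      unfolding p_def using P k assms(2) by (intro abs_prod_minus_one_le) auto
    \<comment> \<open>The product has \<open>n - k\<close> factors, at most \<open>n - 1\<close>
      because \<open>k\<close> starts at 1.\<close>
    also have "\<dots> \<le> (1 + \<sigma>) ^ (n - 1) - 1"
      using k assms(2) by (intro diff_right_mono power_increasing) auto
    also note pow
    finally have p: "\<bar>p - 1\<bar> \<le> d" .
    have ck: "\<bar>c k - 1\<bar> \<le> \<tau>" using c k by blast
    have eq: "p * c k - 1 = (p - 1) * (c k - 1) + (p - 1) + (c k - 1)" by (simp add: algebra_simps)
    have "\<bar>p * c k - 1\<bar> \<le> \<bar>p - 1\<bar> * \<bar>c k - 1\<bar> + \<bar>p - 1\<bar> + \<bar>c k - 1\<bar>"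
      unfolding eq abs_mult[symmetric] by (rule abs_triangle_ineq_three)
    also have "\<dots> \<le> d * \<tau> + d + \<tau>"
      using p ck by (intro add_mono mult_mono) auto
    finally have "\<bar>p * c k - 1\<bar> * \<bar>x k\<bar> \<le> (d * \<tau> + d + \<tau>) * \<bar>x k\<bar>"
      by (rule mult_right_mono) simp
    moreover have "p * c k * x k - x k = (p * c k - 1) * x k" by (simp add: left_diff_distrib)
    ultimately show ?thesis unfolding p_def[symmetric] by (simp add: abs_mult add_ac)
  qed
  have "\<bar>(\<Sum>k=1..n. (\<Prod>i=k+1..n. P i) * c k * x k) - (\<Sum>k=1..n. x k)\<bar>
    \<le> (\<Sum>k=1..n. \<bar>(\<Prod>i=k+1..n. P i) * c k * x k - x k\<bar>)"
    unfolding sum_subtractf[symmetric] by (rule sum_abs)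
  also have "\<dots> \<le> (\<Sum>k=1..n. (\<tau> + d + d * \<tau>) * \<bar>x k\<bar>)" by (intro sum_mono each)
  also have "\<dots> = (\<tau> + d + d * \<tau>) * (\<Sum>k=1..n. \<bar>x k\<bar>)" by (simp only: sum_distrib_left)
  also have "\<dots> = \<tau> * (\<Sum>k=1..n. \<bar>x k\<bar>) + d * (\<Sum>k=1..n. \<bar>x k\<bar>)
      + (real n - 1) * \<sigma> * \<tau> / (1 - (real n - 1) * \<sigma>) * (\<Sum>k=1..n. \<bar>x k\<bar>)"
    unfolding d_def by (simp add: distrib_right)
  finally show ?thesis unfolding d_def .
qed

lemma abs_mult_le_power:
  fixes a b c d \<epsilon> :: real
  assumes "\<bar>a\<bar> \<le> \<epsilon>" "\<bar>b\<bar> \<le> \<epsilon>" "\<bar>c\<bar> \<le> \<epsilon>" "\<bar>d\<bar> \<le> \<epsilon>"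
  shows "\<bar>a * b\<bar> \<le> \<epsilon> ^ 2" "\<bar>a * b * c\<bar> \<le> \<epsilon> ^ 3" "\<bar>a * b * c * d\<bar> \<le> \<epsilon> ^ 4"
proof -
  have \<epsilon>: "0 \<le> \<epsilon>" using assms(1) by linarith
  have eqs: "\<epsilon> ^ 2 = \<epsilon> * \<epsilon>" "\<epsilon> ^ 3 = \<epsilon> * \<epsilon> * \<epsilon>" "\<epsilon> ^ 4 = \<epsilon> * \<epsilon> * \<epsilon> * \<epsilon>"
    by (simp_all add: eval_nat_numeral)
  show "\<bar>a * b\<bar> \<le> \<epsilon> ^ 2" "\<bar>a * b * c\<bar> \<le> \<epsilon> ^ 3" "\<bar>a * b * c * d\<bar> \<le> \<epsilon> ^ 4"
    unfolding eqs abs_mult using assms \<epsilon> by (intro mult_mono; simp)+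
qed

section \<open>Error analysis of the compensated summation\<close>

theorem mainTheorem5:
  fixes t n :: nat and Emin Emax :: int
    and fl :: "real \<Rightarrow> real"
    and x s e y u tt v w :: "nat \<Rightarrow> real"
    and \<epsilon> \<sigma> \<tau> stilde :: real
  assumes "t \<ge> 1" and "Emin \<le> Emax"
    and "nearest_rounding (dekker_floats t Emin Emax) fl"
    and "n \<ge> 1"
    and "\<And>i. i \<in> {1..n} \<Longrightarrow> x i \<in> dekker_floats t Emin Emax"
    and "s 0 = 0" and "e 0 = 0"
    and "\<And>i. i \<in> {1..n} \<Longrightarrow> (y i, u i) = add6 fl (e (i - 1)) (x i)"
    and "\<And>i. i \<in> {1..n} \<Longrightarrow> (tt i, v i) = add6 fl (s (i - 1)) (y i)"
    and "\<And>i. i \<in> {1..n} \<Longrightarrow> w i = fl (u i + v i)"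
    and "\<And>i. i \<in> {1..n} \<Longrightarrow> (s i, e i) = add6 fl (tt i) (w i)"
    and "\<And>i. i \<in> {1..n} \<Longrightarrow> add6_no_overflow fl (max_float t Emax) (e (i - 1)) (x i)"
    and "\<And>i. i \<in> {1..n} \<Longrightarrow> add6_no_overflow fl (max_float t Emax) (s (i - 1)) (y i)"
    and "\<And>i. i \<in> {1..n} \<Longrightarrow> \<bar>u i + v i\<bar> \<le> max_float t Emax"
    and "\<And>i. i \<in> {1..n} \<Longrightarrow> add6_no_overflow fl (max_float t Emax) (tt i) (w i)"
    and "stilde = (\<Sum>k=1..n. x k)"
    and "\<epsilon> = unit_roundoff t"
    and "\<sigma> = \<epsilon> ^ 2 + \<epsilon> ^ 3 + \<epsilon> ^ 4"
    and "\<tau> = 2 * \<epsilon> ^ 2 + \<epsilon> ^ 3"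
  shows
    "(\<exists>\<alpha> \<beta> \<gamma> \<eta> :: nat \<Rightarrow> real.
        \<eta> 0 = 0 \<and>
        (\<forall>i\<in>{1..n}.
           \<bar>\<alpha> i\<bar> \<le> \<epsilon> \<and> \<bar>\<beta> i\<bar> \<le> \<epsilon> \<and> \<bar>\<gamma> i\<bar> \<le> \<epsilon> \<and> \<bar>\<eta> i\<bar> \<le> \<epsilon> \<and>
           y i = (1 + \<alpha> i) * (e (i - 1) + x i) \<and>
           u i = - \<alpha> i * (e (i - 1) + x i) \<and>
           tt i = (1 + \<beta> i) * (s (i - 1) + y i) \<and>
           v i = - \<beta> i * (s (i - 1) + y i) \<and>
           w i = (1 + \<gamma> i) * (u i + v i) \<and>
           s i = (1 + \<eta> i) * (tt i + w i) \<and>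
           e i = - \<eta> i * (tt i + w i) \<and>
           s i + e i =
             (1 - \<gamma> i * \<beta> i + \<gamma> i * \<alpha> i * \<eta> (i - 1) + \<gamma> i * \<beta> i * \<alpha> i * \<eta> (i - 1))
               * (s (i - 1) + e (i - 1))
             + (1 - \<gamma> i * \<alpha> i - \<gamma> i * \<beta> i - \<gamma> i * \<beta> i * \<alpha> i) * x i) \<and>
        s n + e n =
          (\<Sum>k=1..n.
             (\<Prod>i=k+1..n.
                1 - \<gamma> i * \<beta> i + \<gamma> i * \<alpha> i * \<eta> (i - 1) + \<gamma> i * \<beta> i * \<alpha> i * \<eta> (i - 1))
             * (1 - \<gamma> k * \<alpha> k - \<gamma> k * \<beta> k - \<gamma> k * \<beta> k * \<alpha> k) * x k))
     \<and>
     (real n * \<sigma> < 1 \<longrightarrow>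
        \<bar>s n + e n - stilde\<bar>
          \<le> \<tau> * (\<Sum>k=1..n. \<bar>x k\<bar>)
            + (real n - 1) * \<sigma> / (1 - (real n - 1) * \<sigma>) * (\<Sum>k=1..n. \<bar>x k\<bar>)
            + (real n - 1) * \<sigma> * \<tau> / (1 - (real n - 1) * \<sigma>) * (\<Sum>k=1..n. \<bar>x k\<bar>) \<and>
        \<bar>s n - stilde\<bar>
          \<le> (1 + \<epsilon>) *
              (\<tau> * (\<Sum>k=1..n. \<bar>x k\<bar>)
               + (real n - 1) * \<sigma> / (1 - (real n - 1) * \<sigma>) * (\<Sum>k=1..n. \<bar>x k\<bar>)
               + (real n - 1) * \<sigma> * \<tau> / (1 - (real n - 1) * \<sigma>) * (\<Sum>k=1..n. \<bar>x k\<bar>))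
            + \<epsilon> * \<bar>\<Sum>k=1..n. x k\<bar>)"
proof -
  note D = assms(1-3)
  let ?F = "dekker_floats t Emin Emax"
  have \<epsilon>: "\<epsilon> \<ge> 0" unfolding assms(17) unit_roundoff_eq by simp
  have zero: "0 \<in> ?F" unfolding dekker_floats_def using assms(2) by (auto intro: exI[of _ 0])
  have flF: "fl r \<in> ?F" for r using assms(3) unfolding nearest_rounding_def by blast
  have add6F: "z \<in> ?F \<and> zz \<in> ?F" if "(z, zz) = add6 fl p q" for z zz p q
    using that flF unfolding add6_def Let_def by simp
  have seF: "s i \<in> ?F" "e i \<in> ?F" if "i \<le> n" for i
  proof -
    have "s i \<in> ?F \<and> e i \<in> ?F"
      using assms(6,7) zero add6F[OF assms(11)[of i]] that by (cases "i = 0") auto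
    then show "s i \<in> ?F" "e i \<in> ?F" by auto
  qed
  define \<alpha> where "\<alpha> i = rel_dev (y i) (e (i - 1) + x i)" for i
  define \<beta> where "\<beta> i = rel_dev (tt i) (s (i - 1) + y i)" for i
  define \<gamma> where "\<gamma> i = rel_dev (w i) (u i + v i)" for i
  \<comment> \<open>\<open>tt 0\<close> and \<open>w 0\<close> are unconstrained, so the value at 0
    is fixed separately; it agrees with \<open>e 0 = 0\<close>.\<close>
  define \<eta> where "\<eta> i = (if i = 0 then 0 else rel_dev (s i) (tt i + w i))" for i
  define P where
    "P i = 1 - \<gamma> i * \<beta> i + \<gamma> i * \<alpha> i * \<eta> (i - 1) + \<gamma> i * \<beta> i * \<alpha> i * \<eta> (i - 1)" for i
  define c where "c i = 1 - \<gamma> i * \<alpha> i - \<gamma> i * \<beta> i - \<gamma> i * \<beta> i * \<alpha> i" for i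
  have basic: "\<bar>\<alpha> i\<bar> \<le> \<epsilon> \<and> \<bar>\<beta> i\<bar> \<le> \<epsilon> \<and> \<bar>\<gamma> i\<bar> \<le> \<epsilon> \<and> \<bar>\<eta> i\<bar> \<le> \<epsilon> \<and>
      y i = (1 + \<alpha> i) * (e (i - 1) + x i) \<and> u i = - \<alpha> i * (e (i - 1) + x i) \<and>
      tt i = (1 + \<beta> i) * (s (i - 1) + y i) \<and> v i = - \<beta> i * (s (i - 1) + y i) \<and>
      w i = (1 + \<gamma> i) * (u i + v i) \<and>
      s i = (1 + \<eta> i) * (tt i + w i) \<and> e i = - \<eta> i * (tt i + w i)"
    if i: "i \<in> {1..n}" for i
  proof -
    have F: "e (i - 1) \<in> ?F" "s (i - 1) \<in> ?F" using seF i by auto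
    note yF = add6F[OF assms(8)[OF i]]
    note tF = add6F[OF assms(9)[OF i]]
    have wF: "w i \<in> ?F" using assms(10)[OF i] flF by simp
    note ex1 = add6_exact(1,2)[OF D F(1) assms(5)[OF i] assms(12)[OF i] assms(8)[OF i],
        folded assms(17)]
    note ex2 = add6_exact(1,2)[OF D F(2) conjunct1[OF yF] assms(13)[OF i] assms(9)[OF i],
        folded assms(17)]
    note ex3 = add6_exact(1,2)[OF D conjunct1[OF tF] wF assms(15)[OF i] assms(11)[OF i],
        folded assms(17)]
    have w: "\<bar>w i - (u i + v i)\<bar> \<le> \<epsilon> * \<bar>u i + v i\<bar>"
      using fl_relative_error[OF D conjunct2[OF yF] conjunct2[OF tF] assms(14)[OF i]]
        assms(10)[OF i] assms(17) by simp
    have \<eta>i: "\<eta> i = rel_dev (s i) (tt i + w i)" using i unfolding \<eta>_def by simp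
    \<comment> \<open>Exactness of \<open>add6\<close> makes the second output the negative of the
      perturbation in the first, with the same coefficient.\<close>
    have residual: "b = - \<delta> * r" if "a + b = r" "a = (1 + \<delta>) * r" for a b \<delta> r :: real
      using that by (simp add: algebra_simps)
    note a = rel_dev[OF ex1(2) \<epsilon>, folded \<alpha>_def]
    note b = rel_dev[OF ex2(2) \<epsilon>, folded \<beta>_def]
    note g = rel_dev[OF w \<epsilon>, folded \<gamma>_def]
    note h = rel_dev[OF ex3(2) \<epsilon>, folded \<eta>i]
    show ?thesis
      using a b g h residual[OF ex1(1) a(2)] residual[OF ex2(1) b(2)] residual[OF ex3(1) h(2)]
      by blast
  qed
  have \<eta>_abs: "\<bar>\<eta> i\<bar> \<le> \<epsilon>" if "i \<le> n" for i
    using basic[of i] that \<epsilon> by (cases "i = 0") (auto simp: \<eta>_def)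
  \<comment> \<open>This expresses the correction through the compensated sum alone, and so brings
    \<open>\<eta> (i - 1)\<close> into the recurrence of the next step.\<close>
  have e_eq: "e i = - \<eta> i * (s i + e i)" if "i \<le> n" for i
  proof (cases "i = 0")
    case True
    then show ?thesis using assms(7) by (simp add: \<eta>_def)
  next
    case False
    then have se: "s i = (1 + \<eta> i) * (tt i + w i)" "e i = - \<eta> i * (tt i + w i)"
      using basic[of i] that by auto
    then have "s i + e i = tt i + w i" by (simp add: algebra_simps)
    then show ?thesis using se(2) by simp
  qed
  have step: "s i + e i = P i * (s (i - 1) + e (i - 1)) + c i * x i" if i: "i \<in> {1..n}" for i
  proof -
    define S where "S = s (i - 1) + e (i - 1)"
    have e': "e (i - 1) = - \<eta> (i - 1) * S" unfolding S_def using e_eq[of "i - 1"] i by auto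
    have s': "s (i - 1) = S - e (i - 1)" unfolding S_def by simp
    from basic[OF i] have yi: "y i = (1 + \<alpha> i) * (e (i - 1) + x i)"
      and ui: "u i = - \<alpha> i * (e (i - 1) + x i)"
      and ti: "tt i = (1 + \<beta> i) * (s (i - 1) + y i)"
      and vi: "v i = - \<beta> i * (s (i - 1) + y i)"
      and wi: "w i = (1 + \<gamma> i) * (u i + v i)"
      and si: "s i = (1 + \<eta> i) * (tt i + w i)" and ei: "e i = - \<eta> i * (tt i + w i)"
      by blast+
    have "s i + e i = tt i + w i" unfolding si ei by (simp add: algebra_simps)
    \<comment> \<open>Both earlier \<open>add6\<close> calls are exact, so
      \<open>tt i + u i + v i = S + x i\<close> and the loss is
      \<open>\<gamma> i * (u i + v i)\<close>. Expanding it in \<open>S\<close> and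
      \<open>x i\<close> gives the deviations of \<open>P i\<close> and \<open>c i\<close> from
      1.\<close>
    also have "\<dots> = P i * S + c i * x i"
      unfolding wi ti ui vi yi s' e' P_def c_def by (simp add: algebra_simps)
    finally show ?thesis unfolding S_def .
  qed
  have sol: "s n + e n = (\<Sum>k=1..n. (\<Prod>i=k+1..n. P i) * c k * x k)"
    using linear_recurrence_solution[of "\<lambda>i. s i + e i" n P "\<lambda>i. c i * x i"] step assms(6,7)
    by (simp add: mult.assoc)
  have P_bound: "\<bar>P i - 1\<bar> \<le> \<sigma>" and c_bound: "\<bar>c i - 1\<bar> \<le> \<tau>" if i: "i \<in> {1..n}" for i
  proof -
    have abg: "\<bar>\<alpha> i\<bar> \<le> \<epsilon>" "\<bar>\<beta> i\<bar> \<le> \<epsilon>" "\<bar>\<gamma> i\<bar> \<le> \<epsilon>" using basic[OF i] by blast+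
    have h: "\<bar>\<eta> (i - 1)\<bar> \<le> \<epsilon>" using i by (intro \<eta>_abs) auto
    \<comment> \<open>The three terms of \<open>P i - 1\<close> have two, three and four factors,
      those of \<open>c i - 1\<close> two, two and three, each factor being at most
      \<open>\<epsilon>\<close>. This is the origin of \<open>\<sigma>\<close> and
      \<open>\<tau>\<close>.\<close>
    note m1 = abs_mult_le_power[OF abg(3,2,1) h]
    note m2 = abs_mult_le_power[OF abg(3,1) h h]
    show "\<bar>P i - 1\<bar> \<le> \<sigma>" using m1(1,3) m2(2) unfolding P_def assms(18) by linarith
    show "\<bar>c i - 1\<bar> \<le> \<tau>" using m1(1,2) m2(1) unfolding c_def assms(19) by linarith
  qed
  have "\<eta> 0 = 0" unfolding \<eta>_def by simp
  moreover note basic step[unfolded P_def c_def] sol[unfolded P_def c_def]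
  ultimately have representation: "\<exists>\<alpha> \<beta> \<gamma> \<eta> :: nat \<Rightarrow> real.
        \<eta> 0 = 0 \<and>
        (\<forall>i\<in>{1..n}.
           \<bar>\<alpha> i\<bar> \<le> \<epsilon> \<and> \<bar>\<beta> i\<bar> \<le> \<epsilon> \<and> \<bar>\<gamma> i\<bar> \<le> \<epsilon> \<and> \<bar>\<eta> i\<bar> \<le> \<epsilon> \<and>
           y i = (1 + \<alpha> i) * (e (i - 1) + x i) \<and>
           u i = - \<alpha> i * (e (i - 1) + x i) \<and>
           tt i = (1 + \<beta> i) * (s (i - 1) + y i) \<and>
           v i = - \<beta> i * (s (i - 1) + y i) \<and>
           w i = (1 + \<gamma> i) * (u i + v i) \<and>
           s i = (1 + \<eta> i) * (tt i + w i) \<and>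
           e i = - \<eta> i * (tt i + w i) \<and>
           s i + e i =
             (1 - \<gamma> i * \<beta> i + \<gamma> i * \<alpha> i * \<eta> (i - 1) + \<gamma> i * \<beta> i * \<alpha> i * \<eta> (i - 1))
               * (s (i - 1) + e (i - 1))
             + (1 - \<gamma> i * \<alpha> i - \<gamma> i * \<beta> i - \<gamma> i * \<beta> i * \<alpha> i) * x i) \<and>
        s n + e n =
          (\<Sum>k=1..n.
             (\<Prod>i=k+1..n.
                1 - \<gamma> i * \<beta> i + \<gamma> i * \<alpha> i * \<eta> (i - 1) + \<gamma> i * \<beta> i * \<alpha> i * \<eta> (i - 1))
             * (1 - \<gamma> k * \<alpha> k - \<gamma> k * \<beta> k - \<gamma> k * \<beta> k * \<alpha> k) * x k)"
    by (intro exI[of _ \<alpha>] exI[of _ \<beta>] exI[of _ \<gamma>] exI[of _ \<eta>] conjI ballI) (simp_all only:)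
  define R where "R = \<tau> * (\<Sum>k=1..n. \<bar>x k\<bar>)
            + (real n - 1) * \<sigma> / (1 - (real n - 1) * \<sigma>) * (\<Sum>k=1..n. \<bar>x k\<bar>)
            + (real n - 1) * \<sigma> * \<tau> / (1 - (real n - 1) * \<sigma>) * (\<Sum>k=1..n. \<bar>x k\<bar>)"
  have "\<bar>s n + e n - stilde\<bar> \<le> R \<and> \<bar>s n - stilde\<bar> \<le> (1 + \<epsilon>) * R + \<epsilon> * \<bar>\<Sum>k=1..n. x k\<bar>"
    if n\<sigma>: "real n * \<sigma> < 1"
  proof -
    have nonneg: "\<sigma> \<ge> 0" "\<tau> \<ge> 0" using \<epsilon> unfolding assms(18,19) by simp_all
    have lt: "(real n - 1) * \<sigma> < 1" using n\<sigma> nonneg(1) by (simp add: left_diff_distrib)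
    have se: "\<bar>s n + e n - stilde\<bar> \<le> R"
      unfolding sol R_def assms(16)
      by (intro perturbed_sum_bound assms(4) nonneg lt P_bound c_bound)
    \<comment> \<open>Dropping the final correction multiplies the compensated sum by
      \<open>1 + \<eta> n\<close>. Splitting off \<open>stilde\<close> yields the factor
      \<open>1 + \<epsilon>\<close> on the compensated error and the extra term
      \<open>\<epsilon> * \<bar>stilde\<bar>\<close>.\<close>
    have "s n = (1 + \<eta> n) * (s n + e n)" using e_eq[of n] by (simp add: algebra_simps)
    then have eq: "s n - stilde = (s n + e n - stilde) + \<eta> n * (s n + e n - stilde) + \<eta> n * stilde"
      by (simp add: algebra_simps)
    have "\<bar>s n - stilde\<bar> \<le> \<bar>s n + e n - stilde\<bar> + \<bar>\<eta> n\<bar> * \<bar>s n + e n - stilde\<bar>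
        + \<bar>\<eta> n\<bar> * \<bar>stilde\<bar>"
      unfolding eq abs_mult[symmetric] by (rule abs_triangle_ineq_three)
    also have "\<dots> \<le> R + \<epsilon> * R + \<epsilon> * \<bar>stilde\<bar>"
      using se \<eta>_abs[of n] \<epsilon> by (intro add_mono mult_mono) auto
    also have "\<dots> = (1 + \<epsilon>) * R + \<epsilon> * \<bar>\<Sum>k=1..n. x k\<bar>"
      unfolding assms(16) by (simp add: distrib_right)
    finally show ?thesis using se by blast
  qed
  then show ?thesis using representation unfolding R_def by blast
qed

end
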